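(* Let $p$ be an odd prime and $n$ a positive integer such that $p\nmid n$ and every group of order $np$ has a normal subgroup of order $p$. Let $(E,\cdot)$ be a group of order $n$ such that $p\nmid|\mathrm{Aut}(E)|$, let $\sigma:E\to\mathbf{Z}_p^*=\mathrm{Aut}(\mathbf{Z}_p)$ be a group homomorphism, and let $(B,\cdot,\circ)$ be a skew brace of size $np$ with additive group $(B,\cdot)=N=\mathbf{Z}_p\rtimes_\sigma E$ and multiplicative group $(B,\circ)=G$. Then the quotient skew brace $B/\mathbf{Z}_p$ (by the ideal $\mathbf{Z}_p=\mathbf{Z}_p\times\{1\}$ of $B$) is a skew brace $(B_n,\cdot,\circ)$ with additive group $(E,\cdot)$ such that $\sigma$ is a skew brace homomorphism $B_n\to\mathbf{Z}_p^*$, and $G\simeq\mathbf{Z}_p\rtimes_\tau(B_n,\circ)$ for some group homomorphism $\tau:(B_n,\circ)\to\mathbf{Z}_p^*$. Moreover, an isomorphism class of skew braces of size $np$ with additive group $\mathbf{Z}_p\rtimes_\sigma E$ provides an isomorphism class of skew braces of size $n$ with additive group $E$; that is, isomorphic skew braces of size $np$ with additive group $\mathbf{Z}_p\rtimes_\sigma E$ have, by this quotient procedure, isomorphic skew braces of size $n$.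
   Context: A skew brace is a triple $(B,\cdot,\circ)$ where $(B,\cdot)$ (the additive group) and $(B,\circ)$ (the multiplicative group) are groups on the same set and $a\circ(b\cdot c)=(a\circ b)\cdot a^{-1}\cdot(a\circ c)$ for all $a,b,c\in B$, with $a^{-1}$ the inverse in $(B,\cdot)$. For $a\in B$ put $\lambda_a(b)=a^{-1}\cdot(a\circ b)$. An ideal of $B$ is a subset $I$ that is a normal subgroup of both $(B,\cdot)$ and $(B,\circ)$ and satisfies $\lambda_a(I)\subseteq I$ for all $a\in B$; then $B/I$ inherits a skew brace structure. Homomorphisms of skew braces preserve both operations. $\mathbf{Z}_p^*$ is regarded as a skew brace with both operations equal to multiplication, so a skew brace homomorphism $B_n\to\mathbf{Z}_p^*$ is a map that is a group homomorphism from both $(B_n,\cdot)$ and $(B_n,\circ)$. $\mathbf{Z}_p$ is the additive cyclic group of order $p$; for a group $H$ and a homomorphism $\rho:H\to\mathbf{Z}_p^*$, the group $\mathbf{Z}_p\rtimes_\rho H$ is $\mathbf{Z}_p\times H$ with operation $(m,a)(m',b)=(m+\rho(a)m',ab)$. The additive group of $B/\mathbf{Z}_p$ is identified with $E$ through $(m,a)\mapsto a$. *)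

theory Defs
  imports
    "HOL-Algebra.Bij"
    "HOL-Algebra.Weak_Morphisms"
    "HOL-Number_Theory.Residues"
begin

record 'a brace_ops =
  additive_group :: "'a monoid"
  multiplicative_group :: "'a monoid"

definition brace_lambda :: "'a brace_ops \<Rightarrow> 'a \<Rightarrow> 'a \<Rightarrow> 'a" where
  "brace_lambda B a b =
     inv\<^bsub>additive_group B\<^esub> a \<otimes>\<^bsub>additive_group B\<^esub> (a \<otimes>\<^bsub>multiplicative_group B\<^esub> b)"

locale skew_brace =
  add: group "additive_group B" + mult: group "multiplicative_group B"
  for B :: "'a brace_ops" +
  assumes same_carrier: "carrier (multiplicative_group B) = carrier (additive_group B)"
    and brace_law:
      "\<lbrakk>a \<in> carrier (additive_group B); b \<in> carrier (additive_group B);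
        c \<in> carrier (additive_group B)\<rbrakk> \<Longrightarrow>
       a \<otimes>\<^bsub>multiplicative_group B\<^esub> (b \<otimes>\<^bsub>additive_group B\<^esub> c) =
       (a \<otimes>\<^bsub>multiplicative_group B\<^esub> b) \<otimes>\<^bsub>additive_group B\<^esub> inv\<^bsub>additive_group B\<^esub> a
         \<otimes>\<^bsub>additive_group B\<^esub> (a \<otimes>\<^bsub>multiplicative_group B\<^esub> c)"

definition brace_ideal :: "'a set \<Rightarrow> 'a brace_ops \<Rightarrow> bool" where
  "brace_ideal I B \<longleftrightarrow>
     I \<lhd> additive_group B \<and> I \<lhd> multiplicative_group B \<and>
     (\<forall>a \<in> carrier (additive_group B). brace_lambda B a ` I \<subseteq> I)"

text \<open>For an ideal the additive and the multiplicative cosets coincide, so the two factor groups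
  have the same carrier.\<close>

definition quotient_brace :: "'a brace_ops \<Rightarrow> 'a set \<Rightarrow> 'a set brace_ops" where
  "quotient_brace B I =
     \<lparr>additive_group = additive_group B Mod I,
      multiplicative_group = multiplicative_group B Mod I\<rparr>"

definition brace_hom :: "'a brace_ops \<Rightarrow> 'b brace_ops \<Rightarrow> ('a \<Rightarrow> 'b) set" where
  "brace_hom B C =
     hom (additive_group B) (additive_group C) \<inter>
     hom (multiplicative_group B) (multiplicative_group C)"

definition brace_iso :: "'a brace_ops \<Rightarrow> 'b brace_ops \<Rightarrow> ('a \<Rightarrow> 'b) set" where
  "brace_iso B C =
     {f \<in> brace_hom B C. bij_betw f (carrier (additive_group B)) (carrier (additive_group C))}"

definition brace_isomorphic :: "'a brace_ops \<Rightarrow> 'b brace_ops \<Rightarrow> bool" where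
  "brace_isomorphic B C \<longleftrightarrow> brace_iso B C \<noteq> {}"


definition Zp_units :: "nat \<Rightarrow> int monoid" where
  "Zp_units p = units_of (residue_ring (int p))"

definition Zp_units_brace :: "nat \<Rightarrow> int brace_ops" where
  "Zp_units_brace p =
     \<lparr>additive_group = Zp_units p, multiplicative_group = Zp_units p\<rparr>"

definition Zp_semidirect :: "nat \<Rightarrow> ('a \<Rightarrow> int) \<Rightarrow> 'a monoid \<Rightarrow> (int \<times> 'a) monoid" where
  "Zp_semidirect p \<rho> H =
     (let R = residue_ring (int p) in
      \<lparr>carrier = carrier R \<times> carrier H,
       monoid.mult = (\<lambda>(m, a) (m', b). (m \<oplus>\<^bsub>R\<^esub> (\<rho> a \<otimes>\<^bsub>R\<^esub> m'), a \<otimes>\<^bsub>H\<^esub> b)),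
       one = (\<zero>\<^bsub>R\<^esub>, \<one>\<^bsub>H\<^esub>)\<rparr>)"

definition Zp_part :: "nat \<Rightarrow> 'a monoid \<Rightarrow> (int \<times> 'a) set" where
  "Zp_part p H = carrier (residue_ring (int p)) \<times> {\<one>\<^bsub>H\<^esub>}"

text \<open>The cosets of \<^term>\<open>Zp_part p E\<close> have the form \<open>carrier (residue_ring p) \<times> {a}\<close>;
  the coset of \<open>(m, a)\<close> is identified with \<open>a\<close>.\<close>

definition coset_label :: "(int \<times> 'a) set \<Rightarrow> 'a" where
  "coset_label C = the_elem (snd ` C)"

text \<open>The skew brace \<open>B\<^sub>n\<close>: the quotient of \<open>B\<close> by \<^term>\<open>Zp_part p E\<close>, carried over to \<open>E\<close> along
  \<^const>\<open>coset_label\<close>.\<close>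

definition reduced_brace :: "nat \<Rightarrow> 'a monoid \<Rightarrow> (int \<times> 'a) brace_ops \<Rightarrow> 'a brace_ops" where
  "reduced_brace p E B =
     \<lparr>additive_group = E,
      multiplicative_group =
        image_group coset_label (multiplicative_group (quotient_brace B (Zp_part p E)))\<rparr>"

end

theory Submission
  imports Defs
begin

text \<open>
  Since \<open>p\<close> does not divide \<open>n\<close>, the subgroup \<open>Z\<^sub>p\<close> consists of all elements of the additive group
  whose order divides \<open>p\<close>; hence every map \<open>\<lambda>\<^sub>a\<close>, being an endomorphism of that group, preserves it.
  It is therefore also a subgroup of the multiplicative group, and it coincides there with the normal
  subgroup of order \<open>p\<close> provided by the hypothesis, so it is an ideal. Any automorphism of
  \<open>Z\<^sub>p \<rtimes>\<^sub>\<sigma> E\<close> acts on \<open>Z\<^sub>p\<close> by a scalar, which commutes with the action of \<open>E\<close>; so the induced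
  automorphism of \<open>E\<close> preserves \<open>\<sigma>\<close>. Applied to \<open>\<lambda>\<^sub>a\<close>, this makes \<open>\<sigma>\<close> multiplicative for \<open>\<circ>\<close>.
  The multiplicative group splits because a crossed homomorphism onto \<open>Z\<^sub>p\<close> extending \<open>x \<mapsto> x\<^sup>n\<close> is
  obtained by summing a factor set over the quotient.
\<close>

section \<open>Splitting off a normal subgroup of prime order\<close>

text \<open>The order of \<open>h x\<close> divides both \<open>m\<close> and
  \<open>order H\<close>. This places elements of order dividing \<open>p\<close> in the kernel of
  any map to a group of order prime to \<open>p\<close>.\<close>

lemma (in group_hom) hom_eq_one_if_coprime_pow:
  assumes x: "x \<in> carrier G" and "x [^] (m :: nat) = \<one>" and "coprime m (order H)"
  shows "h x = \<one>\<^bsub>H\<^esub>"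
proof -
  have "h x [^]\<^bsub>H\<^esub> m = \<one>\<^bsub>H\<^esub>"
    using assms by (simp flip: hom_nat_pow)
  moreover have "h x [^]\<^bsub>H\<^esub> order H = \<one>\<^bsub>H\<^esub>"
    using x by (simp add: H.pow_order_eq_1)
  ultimately have "H.ord (h x) dvd gcd m (order H)"
    using x by (simp add: H.pow_eq_id)
  then show ?thesis
    using assms H.ord_eq_1[of "h x"] by simp
qed

lemma (in group) subgroup_pow_card:
  assumes "subgroup K G" "x \<in> K"
  shows "x [^] card K = \<one>"
proof -
  interpret K: group "G\<lparr>carrier := K\<rparr>"
    using assms(1) subgroup_imp_group by blast
  show ?thesis
    using K.pow_order_eq_1[of x] assms nat_pow_consistent[of x "card K" K]
    by (simp add: order_def)
qed

text \<open>Any non-identity element generates, since its order divides a prime. Integer exponents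
  can later be negated and subtracted.\<close>

lemma (in group) prime_card_subgroup_generator:
  assumes K: "subgroup K G" and "prime (card K)"
  obtains z where "z \<in> carrier G" "ord z = card K" "K = range (\<lambda>k :: int. z [^] k)"
proof -
  have "card K > 1" using assms(2) prime_gt_1_nat by blast
  have "K \<noteq> {\<one>}" using \<open>card K > 1\<close> by auto
  then obtain z where z: "z \<in> K" "z \<noteq> \<one>"
    using subgroup.one_closed[OF K] by blast
  have zG: "z \<in> carrier G" using K z subgroup.subset by blast
  have "ord z dvd card K"
    using subgroup_pow_card[OF K z(1)] zG by (simp add: pow_eq_id)
  then have ord: "ord z = card K"
    using assms(2) z(2) zG by (metis prime_nat_iff ord_eq_1)
  let ?S = "(\<lambda>k :: int. z [^] k) ` {0..<int (card K)}"
  have "inj_on (\<lambda>k :: int. z [^] k) {0..<int (card K)}"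
  proof (rule inj_onI)
    fix k l assume k: "k \<in> {0..<int (card K)}" "l \<in> {0..<int (card K)}" "z [^] k = z [^] l"
    then have "[l = k] (mod int (card K))"
      using int_pow_eq[OF zG, of k l] ord by (simp add: cong_iff_dvd_diff)
    then show "k = l" using k by (simp add: cong_def)
  qed
  then have card: "card ?S = card K" by (simp add: card_image)
  have sub: "range (\<lambda>k :: int. z [^] k) \<subseteq> K"
    using subgroup_int_pow_closed[OF K z(1)] by blast
  have "?S = K"
    using card sub \<open>card K > 1\<close> card.infinite by (intro card_subset_eq) fastforce+
  then have "K = range (\<lambda>k :: int. z [^] k)" using sub by blast
  with that zG ord show thesis by blast
qed

section \<open>Representatives modulo \<open>p\<close> for \<open>Zp_units\<close> and
  \<open>Zp_semidirect\<close>\<close>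

lemma carrier_Zp_units: "prime p \<Longrightarrow> carrier (Zp_units p) = {1..int p - 1}"
  using residues_prime.res_prime_units_eq[of p] prime_gt_0_nat[of p]
  by (simp add: residues_prime_def Zp_units_def units_of_carrier of_nat_diff)

lemma mult_Zp_units [simp]: "x \<otimes>\<^bsub>Zp_units p\<^esub> y = x * y mod int p"
  by (simp add: Zp_units_def units_of_mult residue_ring_def)

lemma carrier_Zp_semidirect:
  "carrier (Zp_semidirect p \<rho> H) = {0..int p - 1} \<times> carrier H"
  by (simp add: Zp_semidirect_def residue_ring_def)

lemma mult_Zp_semidirect [simp]:
  "(m, a) \<otimes>\<^bsub>Zp_semidirect p \<rho> H\<^esub> (m', b) = ((m + \<rho> a * m') mod int p, a \<otimes>\<^bsub>H\<^esub> b)"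
  by (simp add: Zp_semidirect_def residue_ring_def mod_simps)

lemma one_Zp_semidirect: "\<one>\<^bsub>Zp_semidirect p \<rho> H\<^esub> = (0, \<one>\<^bsub>H\<^esub>)"
  by (simp add: Zp_semidirect_def residue_ring_def)

text \<open>A case of the Schur-Zassenhaus theorem. The complement stays implicit, as the zero set
  modulo \<open>p\<close> of the crossed homomorphism \<open>F\<close>.\<close>

lemma iso_Zp_semidirect:
  fixes G (structure) and H :: "'b monoid"
  assumes "group_hom G H h"
    and surj: "h ` carrier G = carrier H" and p: "prime p"
    and card: "card (kernel G H h) = p" and ndvd: "\<not> p dvd order H" 
  shows "\<exists>\<tau> \<in> hom H (Zp_units p). G \<cong> Zp_semidirect p \<tau> H"
proof -
  interpret group_hom G H h by fact
  let ?K = "kernel G H h"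
  have p1: "1 < int p" using prime_gt_1_nat[OF p] by simp
  obtain z where z: "z \<in> carrier G" "G.ord z = p" and K: "?K = range (\<lambda>k :: int. z [^] k)"
    using G.prime_card_subgroup_generator[OF subgroup_kernel] p card by metis
  \<comment> \<open>A discrete logarithm, determined only modulo \<open>p\<close>, so all exponents are compared by congruences.\<close>
  define \<psi> where "\<psi> x = (SOME k :: int. z [^] k = x)" for x
  have \<psi>: "z [^] \<psi> x = x" if "x \<in> carrier G" "h x = \<one>\<^bsub>H\<^esub>" for x
  proof -
    have "x \<in> ?K" using that by (simp add: kernel_def)
    then have "\<exists>k :: int. z [^] k = x" using K by auto
    then show ?thesis unfolding \<psi>_def by (rule someI_ex)
  qed
  have hz: "h (z [^] k) = \<one>\<^bsub>H\<^esub>" for k :: int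
  proof -
    have "z [^] k \<in> ?K" using K by blast
    then show ?thesis by (simp add: kernel_def)
  qed
  have z_eq: "z [^] k = z [^] l \<longleftrightarrow> [k = l] (mod int p)" for k l :: int
    using G.int_pow_eq[OF z(1), of l k] z(2) by (auto simp: cong_iff_dvd_diff eq_commute)
  have z_add: "z [^] (k + l) = z [^] k \<otimes> z [^] l" for k l :: int
    using z(1) by (rule G.int_pow_mult)

  \<comment> \<open>Conjugation by \<open>g\<close> raises \<open>z\<close> to the power
    \<open>t g\<close>; modulo \<open>p\<close> this action becomes \<open>\<tau>\<close>.\<close>
  define t where "t g = \<psi> (g \<otimes> z \<otimes> inv g)" for g
  have zt: "z [^] (t g * k) = g \<otimes> z [^] k \<otimes> inv g" if g: "g \<in> carrier G" for g and k :: int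
  proof -
    have "(\<lambda>x. g \<otimes> x \<otimes> inv g) \<in> hom G G"
      using g by (auto simp: hom_def G.m_assoc G.inv_solve_left)
    then have "(g \<otimes> z \<otimes> inv g) [^] k = g \<otimes> z [^] k \<otimes> inv g"
      using Group.hom_int_pow[OF _ z(1) G.group_axioms G.group_axioms] by fastforce
    moreover have "z [^] t g = g \<otimes> z \<otimes> inv g"
      unfolding t_def using g z(1) hz[of 1] by (intro \<psi>) (auto simp: G.int_pow_1)
    ultimately show ?thesis using z(1) by (metis G.int_pow_pow)
  qed
  have t_mult: "[t (g \<otimes> g') = t g * t g'] (mod int p)" if "g \<in> carrier G" "g' \<in> carrier G" for g g'
  proof -
    have "z [^] t (g \<otimes> g') = g \<otimes> z [^] t g' \<otimes> inv g"
      using zt[of "g \<otimes> g'" 1] zt[of g' 1] that z by (simp add: G.m_assoc G.inv_mult_group)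
    then show ?thesis using zt[of g "t g'"] that by (simp flip: z_eq)
  qed
  \<comment> \<open>The kernel is cyclic, so it acts trivially on itself; this lets \<open>t\<close>
    descend to \<open>H\<close> in \<open>t_cong\<close>.\<close>
  have t_ker: "[t (z [^] k) = 1] (mod int p)" for k :: int
  proof -
    have "z [^] (t (z [^] k) * 1) = z [^] (k + 1 - k)"
      using zt[of "z [^] k" 1] z by (simp only: z_add G.int_pow_diff) auto
    then show ?thesis by (simp add: z_eq)
  qed
  have ker_quot: "\<exists>k :: int. g = z [^] k \<otimes> g'"
    if "g \<in> carrier G" "g' \<in> carrier G" "h g = h g'" for g g'
  proof -
    have "z [^] \<psi> (g \<otimes> inv g') = g \<otimes> inv g'" using that by (intro \<psi>) auto
    then have "g = z [^] \<psi> (g \<otimes> inv g') \<otimes> g'" using that by (simp add: G.m_assoc)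
    then show ?thesis ..
  qed
  have t_cong: "[t g = t g'] (mod int p)"
    if "g \<in> carrier G" "g' \<in> carrier G" "h g = h g'" for g g'
  proof -
    from ker_quot[OF that] obtain k :: int where "g = z [^] k \<otimes> g'" ..
    then have "[t g = t (z [^] k) * t g'] (mod int p)" using t_mult[of "z [^] k" g'] that z by simp
    also have "[t (z [^] k) * t g' = 1 * t g'] (mod int p)" by (intro cong_mult t_ker cong_refl)
    finally show ?thesis by simp
  qed

  define s where "s = inv_into (carrier G) h"
  have s [simp]: "s a \<in> carrier G" "h (s a) = a" if "a \<in> carrier H" for a
    using that surj unfolding s_def by (auto intro: inv_into_into f_inv_into_f)
  \<comment> \<open>The element \<open>g \<otimes> s a\<close> and the chosen lift of its image in
    \<open>H\<close> differ by a power of \<open>z\<close>; \<open>c g a\<close> is the exponent.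
    For \<open>g = s b\<close> this is the usual factor set.\<close>
  define c where "c g a = \<psi> (g \<otimes> s a \<otimes> inv (s (h g \<otimes>\<^bsub>H\<^esub> a)))" for g a
  have zc: "z [^] c g a = g \<otimes> s a \<otimes> inv (s (h g \<otimes>\<^bsub>H\<^esub> a))"
    if "g \<in> carrier G" "a \<in> carrier H" for g a
    unfolding c_def using that by (intro \<psi>) auto
  \<comment> \<open>\<open>F\<close> is a crossed homomorphism to \<open>Z\<^sub>p\<close> that multiplies exponents of \<open>z\<close> by the order of \<open>H\<close>,
    hence is bijective on the kernel; thus \<open>g \<mapsto> (F g, h g)\<close> is an isomorphism.\<close>
  define F where "F g = (\<Sum>a \<in> carrier H. c g a)" for g
  \<comment> \<open>First correct \<open>g' \<otimes> s a\<close> to a chosen lift, then apply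
    \<open>g\<close>: moving the correction past \<open>g\<close> multiplies its exponent by
    \<open>t g\<close>.\<close>
  have c_mult: "[c (g \<otimes> g') a = c g (h g' \<otimes>\<^bsub>H\<^esub> a) + t g * c g' a] (mod int p)"
    if "g \<in> carrier G" "g' \<in> carrier G" "a \<in> carrier H" for g g' a
  proof -
    have "z [^] c (g \<otimes> g') a = (g \<otimes> z [^] c g' a \<otimes> inv g) \<otimes> z [^] c g (h g' \<otimes>\<^bsub>H\<^esub> a)"
      using that by (simp add: zc G.m_assoc H.m_assoc G.inv_solve_left flip: G.m_assoc[of "inv g" g])
    also have "\<dots> = z [^] (t g * c g' a + c g (h g' \<otimes>\<^bsub>H\<^esub> a))"
      using that by (simp add: z_add zt)
    finally show ?thesis by (simp add: z_eq add.commute)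
  qed
  have F_mult: "[F (g \<otimes> g') = F g + t g * F g'] (mod int p)"
    if g: "g \<in> carrier G" "g' \<in> carrier G" for g g'
  proof -
    \<comment> \<open>Left translation by \<open>h g'\<close> permutes \<open>H\<close>, so the
      shift disappears on summation.\<close>
    have "(\<Sum>a \<in> carrier H. c g (h g' \<otimes>\<^bsub>H\<^esub> a)) = F g"
      unfolding F_def using g
      by (intro sum.reindex_bij_betw) (simp add: bij_betw_def H.inj_on_cmult H.surj_const_mult)
    moreover have "[F (g \<otimes> g') = (\<Sum>a \<in> carrier H. c g (h g' \<otimes>\<^bsub>H\<^esub> a) + t g * c g' a)] (mod int p)"
      unfolding F_def using g by (intro cong_sum c_mult)
    ultimately show ?thesis by (simp add: sum.distrib sum_distrib_left F_def)
  qed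
  have F_ker: "[F (z [^] k) = int (order H) * k] (mod int p)" for k :: int
  proof -
    have "[F (z [^] k) = (\<Sum>a \<in> carrier H. k)] (mod int p)"
      unfolding F_def
    proof (rule cong_sum)
      fix a assume "a \<in> carrier H"
      then have "z [^] c (z [^] k) a = z [^] k"
        using z by (simp add: zc hz G.m_assoc)
      then show "[c (z [^] k) a = k] (mod int p)" by (simp add: z_eq)
    qed
    then show ?thesis by (simp add: order_def)
  qed
  have F_ker_mult: "[F (z [^] k \<otimes> g) = int (order H) * k + F g] (mod int p)"
    if "g \<in> carrier G" for g and k :: int
  proof -
    have "[F (z [^] k \<otimes> g) = F (z [^] k) + t (z [^] k) * F g] (mod int p)"
      using F_mult that z by simp
    also have "[F (z [^] k) + t (z [^] k) * F g = int (order H) * k + 1 * F g] (mod int p)"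
      by (intro cong_add cong_mult F_ker t_ker cong_refl)
    finally show ?thesis by simp
  qed

  \<comment> \<open>Reduction modulo \<open>p\<close> selects the representative that lies in the
    carrier of \<open>Zp_units\<close>.\<close>
  define \<tau> where "\<tau> a = t (s a) mod int p" for a
  have \<tau>: "[\<tau> (h g) = t g] (mod int p)" if "g \<in> carrier G" for g
    using t_cong[of "s (h g)" g] that by (simp add: \<tau>_def)
  have \<tau>_mult: "\<tau> (a \<otimes>\<^bsub>H\<^esub> b) = \<tau> a * \<tau> b mod int p" if "a \<in> carrier H" "b \<in> carrier H" for a b
  proof -
    have "[\<tau> (h (s a \<otimes> s b)) = t (s a) * t (s b)] (mod int p)"
      using that by (intro cong_trans[OF \<tau> t_mult]) auto
    then show ?thesis using that by (simp add: \<tau>_def cong_def mod_simps)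
  qed
  have \<tau>_one: "\<tau> \<one>\<^bsub>H\<^esub> = 1"
    using \<tau>[OF G.one_closed] t_ker[of 0] p1 by (simp add: cong_def \<tau>_def)
  have \<tau>_hom: "\<tau> \<in> hom H (Zp_units p)"
  proof (rule homI)
    fix a assume a: "a \<in> carrier H"
    have "\<tau> a * \<tau> (inv\<^bsub>H\<^esub> a) mod int p = 1"
      using \<tau>_mult[of a "inv\<^bsub>H\<^esub> a"] a \<tau>_one by simp
    then have "\<tau> a \<noteq> 0" by auto
    moreover have "0 \<le> \<tau> a" "\<tau> a < int p" using p1 by (simp_all add: \<tau>_def)
    ultimately show "\<tau> a \<in> carrier (Zp_units p)" by (simp add: carrier_Zp_units[OF p])
  qed (simp add: \<tau>_mult)

  let ?S = "Zp_semidirect p \<tau> H"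
  have cop: "coprime (int (order H)) (int p)"
    using ndvd p by (simp add: coprime_commute prime_imp_coprime)
  have "(\<lambda>g. (F g mod int p, h g)) \<in> iso G ?S"
  proof (rule isoI)
    show "(\<lambda>g. (F g mod int p, h g)) \<in> hom G ?S"
    proof (rule homI)
      fix g g' assume g: "g \<in> carrier G" "g' \<in> carrier G"
      have "[F (g \<otimes> g') = F g + \<tau> (h g) * F g'] (mod int p)"
        using g by (intro cong_trans[OF F_mult] cong_add cong_mult cong_refl cong_sym[OF \<tau>])
      then show "(F (g \<otimes> g') mod int p, h (g \<otimes> g')) =
          (F g mod int p, h g) \<otimes>\<^bsub>?S\<^esub> (F g' mod int p, h g')"
        using g by (simp add: cong_def mod_add_eq) (metis mod_add_eq mod_mult_right_eq mod_mod_trivial)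
    qed (use p1 in \<open>simp add: carrier_Zp_semidirect\<close>)
    show "bij_betw (\<lambda>g. (F g mod int p, h g)) (carrier G) (carrier ?S)"
      unfolding bij_betw_def
    proof
      show "inj_on (\<lambda>g. (F g mod int p, h g)) (carrier G)"
      proof (rule inj_onI)
        fix g g' assume g: "g \<in> carrier G" "g' \<in> carrier G"
          and eq: "(F g mod int p, h g) = (F g' mod int p, h g')"
        \<comment> \<open>Within a fibre of \<open>h\<close>, multiplying by \<open>z [^] k\<close>
          shifts \<open>F\<close> by \<open>order H * k\<close>, which vanishes modulo
          \<open>p\<close> only if \<open>p\<close> divides \<open>k\<close>.\<close>
        from ker_quot[OF g] eq obtain k :: int where k: "g = z [^] k \<otimes> g'" by auto
        have "[0 + F g' = int (order H) * k + F g'] (mod int p)"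
          using F_ker_mult[OF g(2), of k] eq by (simp add: k[symmetric] cong_def)
        then have "int p dvd int (order H) * k"
          by (simp only: cong_add_rcancel) (metis cong_sym cong_0_iff)
        then have "int p dvd k" using cop by (simp add: coprime_commute coprime_dvd_mult_right_iff)
        then have "z [^] k = z [^] (0 :: int)" by (simp only: z_eq cong_0_iff)
        then show "g = g'" using k g by simp
      qed
      show "(\<lambda>g. (F g mod int p, h g)) ` carrier G = carrier ?S"
      proof
        show "(\<lambda>g. (F g mod int p, h g)) ` carrier G \<subseteq> carrier ?S"
          using p1 by (auto simp: carrier_Zp_semidirect)
        show "carrier ?S \<subseteq> (\<lambda>g. (F g mod int p, h g)) ` carrier G"
        proof
          fix x assume "x \<in> carrier ?S"
          then obtain m a where x: "x = (m, a)" "0 \<le> m" "m < int p" "a \<in> carrier H"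
            by (auto simp: carrier_Zp_semidirect)
          obtain u where u: "[int (order H) * u = 1] (mod int p)"
            using cong_solve_coprime_int[OF cop] by blast
          \<comment> \<open>As \<open>u\<close> inverts \<open>order H\<close> modulo
            \<open>p\<close>, this power of \<open>z\<close> shifts \<open>F (s a)\<close> to
            exactly \<open>m\<close>.\<close>
          define g where "g = z [^] (u * (m - F (s a))) \<otimes> s a"
          have "[F g = int (order H) * u * (m - F (s a)) + F (s a)] (mod int p)"
            unfolding g_def mult.assoc using x by (intro F_ker_mult) simp
          also have "[int (order H) * u * (m - F (s a)) + F (s a) = 1 * (m - F (s a)) + F (s a)] (mod int p)"
            by (intro cong_add cong_mult u cong_refl)
          finally have "F g mod int p = m" using x by (simp add: cong_def)
          moreover have "g \<in> carrier G" "h g = a" using x z by (simp_all add: g_def hz)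
          ultimately show "x \<in> (\<lambda>g. (F g mod int p, h g)) ` carrier G"
            using x(1) by force
        qed
      qed
    qed
  qed
  then show ?thesis using \<tau>_hom is_isoI by blast
qed

section \<open>Skew braces and their quotients\<close>

text \<open>A hypothesis about all groups of a given order has to fix a carrier type;
  \<open>nat\<close> suffices because every finite group has a copy on an initial segment.\<close>

lemma (in group) exists_normal_subgroup_transfer:
  assumes all: "\<forall>H :: nat monoid. group H \<and> order H = order G \<longrightarrow> (\<exists>K. K \<lhd> H \<and> card K = k)"
    and fin: "finite (carrier G)"
  shows "\<exists>K. K \<lhd> G \<and> card K = k"
proof -
  obtain f :: "'a \<Rightarrow> nat" where f: "bij_betw f (carrier G) {0..<order G}"
    using ex_bij_betw_finite_nat[OF fin] by (auto simp: order_def)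
  let ?H = "image_group f G"
  have inj: "inj_on f (carrier G)" using f by (simp add: bij_betw_def)
  have iso: "f \<in> iso G ?H" using inj by (rule inj_imp_image_group_iso)
  have H: "group ?H" using inj by (rule inj_imp_image_group_is_group)
  have "order ?H = order G" using inj by (simp add: order_def image_group_carrier card_image)
  with all H obtain K where K: "K \<lhd> ?H" "card K = k" by blast
  let ?g = "inv_into (carrier G) f"
  have g: "?g \<in> iso ?H G" using iso by (rule iso_set_sym)
  have "?g ` K \<lhd> G"
    using iso_normal_subgroup[OF g H group_axioms K(1)] .
  moreover have "inj_on ?g K"
    using g normal_imp_subgroup[OF K(1)] subgroup.subset inj_on_subset by (fastforce simp: iso_iff)
  then have "card (?g ` K) = k" using K(2) by (simp add: card_image)
  ultimately show ?thesis by blast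
qed

context skew_brace
begin

abbreviation brace_add (infixl \<open>\<cdot>\<close> 70) where "a \<cdot> b \<equiv> a \<otimes>\<^bsub>additive_group B\<^esub> b"
abbreviation brace_mult (infixl \<open>\<bullet>\<close> 70) where "a \<bullet> b \<equiv> a \<otimes>\<^bsub>multiplicative_group B\<^esub> b"

lemma mult_closed [simp]:
  "a \<in> carrier (additive_group B) \<Longrightarrow> b \<in> carrier (additive_group B) \<Longrightarrow>
    a \<bullet> b \<in> carrier (additive_group B)"
  using mult.m_closed by (simp add: same_carrier)

lemma mult_inv_closed [simp]:
  "a \<in> carrier (additive_group B) \<Longrightarrow> inv\<^bsub>multiplicative_group B\<^esub> a \<in> carrier (additive_group B)"
  using mult.inv_closed by (simp add: same_carrier)

lemma one_eq: "\<one>\<^bsub>multiplicative_group B\<^esub> = \<one>\<^bsub>additive_group B\<^esub>"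
proof -
  let ?e = "\<one>\<^bsub>multiplicative_group B\<^esub>" and ?z = "\<one>\<^bsub>additive_group B\<^esub>"
  have e: "?e \<in> carrier (additive_group B)" using mult.one_closed by (simp add: same_carrier)
  \<comment> \<open>With \<open>?e\<close> neutral for \<open>\<bullet>\<close>, this instance of
    the brace law collapses: \<open>?z\<close> is the additive inverse of \<open>?e\<close>.\<close>
  have "?e \<bullet> (?z \<cdot> ?z) = (?e \<bullet> ?z) \<cdot> inv\<^bsub>additive_group B\<^esub> ?e \<cdot> (?e \<bullet> ?z)"
    using e by (intro brace_law) simp_all
  then have "?z = inv\<^bsub>additive_group B\<^esub> ?e" using e by (simp add: same_carrier)
  then show ?thesis using e by (metis add.inv_inv add.inv_one)
qed

section \<open>The lambda action of the multiplicative group on the additive group\<close>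

lemma lambda_closed [simp]:
  "a \<in> carrier (additive_group B) \<Longrightarrow> b \<in> carrier (additive_group B) \<Longrightarrow>
    brace_lambda B a b \<in> carrier (additive_group B)"
  by (simp add: brace_lambda_def)

lemma mult_eq_add_lambda:
  "a \<in> carrier (additive_group B) \<Longrightarrow> b \<in> carrier (additive_group B) \<Longrightarrow>
    a \<bullet> b = a \<cdot> brace_lambda B a b"
  by (simp add: brace_lambda_def flip: add.m_assoc)

lemma lambda_hom:
  "a \<in> carrier (additive_group B) \<Longrightarrow>
    brace_lambda B a \<in> hom (additive_group B) (additive_group B)"
  by (rule homI) (simp_all add: brace_lambda_def brace_law add.m_assoc)

text \<open>Bracketing \<open>a \<bullet> b \<bullet> x\<close> in two ways shows that lambda is an
  action, so each lambda map can be undone by that of the multiplicative inverse.\<close>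

lemma lambda_mult:
  assumes "a \<in> carrier (additive_group B)" "b \<in> carrier (additive_group B)"
    "x \<in> carrier (additive_group B)"
  shows "brace_lambda B (a \<bullet> b) x = brace_lambda B a (brace_lambda B b x)"
proof -
  have "(a \<bullet> b) \<bullet> x = a \<bullet> (b \<cdot> brace_lambda B b x)"
    using assms by (simp add: mult.m_assoc same_carrier flip: mult_eq_add_lambda)
  also have "\<dots> = (a \<bullet> b) \<cdot> brace_lambda B a (brace_lambda B b x)"
    using assms brace_law[of a b "brace_lambda B b x"] by (simp add: brace_lambda_def add.m_assoc)
  finally show ?thesis
    using assms by (simp add: brace_lambda_def[of B "a \<bullet> b"] flip: add.m_assoc)
qed

lemma lambda_inv_cancel:
  assumes "a \<in> carrier (additive_group B)" "x \<in> carrier (additive_group B)"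
  shows "brace_lambda B a (brace_lambda B (inv\<^bsub>multiplicative_group B\<^esub> a) x) = x"
proof -
  have "brace_lambda B a (brace_lambda B (inv\<^bsub>multiplicative_group B\<^esub> a) x)
      = brace_lambda B \<one>\<^bsub>additive_group B\<^esub> x"
    using assms by (simp add: same_carrier one_eq flip: lambda_mult)
  also have "\<dots> = x"
    using assms mult.l_one[of x] by (simp add: brace_lambda_def same_carrier one_eq)
  finally show ?thesis .
qed

section \<open>Ideals and quotient skew braces\<close>

lemma ideal_lambda_image:
  assumes I: "brace_ideal I B" and a: "a \<in> carrier (additive_group B)"
  shows "brace_lambda B a ` I = I"
proof
  show "brace_lambda B a ` I \<subseteq> I" using I a by (simp add: brace_ideal_def)
  show "I \<subseteq> brace_lambda B a ` I"
  proof
    fix x assume x: "x \<in> I"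
    let ?y = "brace_lambda B (inv\<^bsub>multiplicative_group B\<^esub> a) x"
    have "x \<in> carrier (additive_group B)"
      using I x normal_imp_subgroup subgroup.mem_carrier by (fastforce simp: brace_ideal_def)
    then have "x = brace_lambda B a ?y" using a by (simp add: lambda_inv_cancel)
    moreover have "?y \<in> I"
      using I x mult_inv_closed[OF a] unfolding brace_ideal_def by blast
    ultimately show "x \<in> brace_lambda B a ` I" by blast
  qed
qed

text \<open>For left cosets, multiplying \<open>I\<close> by \<open>a\<close> under
  \<open>\<bullet>\<close> amounts to adding \<open>a\<close> to the lambda image of
  \<open>I\<close>, which is \<open>I\<close> itself. Normality in both groups turns these into
  right cosets.\<close>

lemma ideal_cosets_eq:
  assumes I: "brace_ideal I B" and a: "a \<in> carrier (additive_group B)"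
  shows "I #>\<^bsub>multiplicative_group B\<^esub> a = I #>\<^bsub>additive_group B\<^esub> a"
proof -
  interpret A: normal I "additive_group B" using I by (simp add: brace_ideal_def)
  interpret M: normal I "multiplicative_group B" using I by (simp add: brace_ideal_def)
  have "I #>\<^bsub>multiplicative_group B\<^esub> a = (\<lambda>x. a \<bullet> x) ` I"
    using M.coset_eq a by (auto simp: same_carrier l_coset_def)
  also have "\<dots> = (\<lambda>x. a \<cdot> x) ` (brace_lambda B a ` I)"
    using a A.mem_carrier by (auto simp: mult_eq_add_lambda image_image)
  also have "\<dots> = I #>\<^bsub>additive_group B\<^esub> a"
    using A.coset_eq a by (auto simp: ideal_lambda_image[OF I a] l_coset_def)
  finally show ?thesis .
qed

lemma carrier_quotient_brace:
  assumes I: "brace_ideal I B"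
  shows "carrier (multiplicative_group (quotient_brace B I)) =
    carrier (additive_group (quotient_brace B I))"
  using ideal_cosets_eq[OF I] by (auto simp: quotient_brace_def carrier_FactGroup same_carrier)

lemma skew_brace_quotient:
  assumes I: "brace_ideal I B"
  shows "skew_brace (quotient_brace B I)"
proof -
  interpret A: normal I "additive_group B" using I by (simp add: brace_ideal_def)
  interpret M: normal I "multiplicative_group B" using I by (simp add: brace_ideal_def)
  let ?A = "additive_group B Mod I" and ?M = "multiplicative_group B Mod I"
  \<comment> \<open>Both quotient operations are evaluated on additive cosets, which reduces the
    brace law to representatives.\<close>
  let ?c = "\<lambda>x. I #>\<^bsub>additive_group B\<^esub> x"
  have add: "?c a \<otimes>\<^bsub>?A\<^esub> ?c b = ?c (a \<cdot> b)"
    if "a \<in> carrier (additive_group B)" "b \<in> carrier (additive_group B)" for a b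
    using that by (simp add: A.rcos_sum)
  have mult: "?c a \<otimes>\<^bsub>?M\<^esub> ?c b = ?c (a \<bullet> b)"
    if "a \<in> carrier (additive_group B)" "b \<in> carrier (additive_group B)" for a b
    using that M.rcos_sum[of a b] by (simp add: ideal_cosets_eq[OF I] same_carrier)
  have inv: "inv\<^bsub>?A\<^esub> (?c a) = ?c (inv\<^bsub>additive_group B\<^esub> a)"
    if "a \<in> carrier (additive_group B)" for a
    using that by (simp add: A.inv_FactGroup A.rcos_inv carrier_FactGroup)
  have "skew_brace \<lparr>additive_group = ?A, multiplicative_group = ?M\<rparr>"
  proof (intro skew_brace.intro skew_brace_axioms.intro)
    show "group (additive_group \<lparr>additive_group = ?A, multiplicative_group = ?M\<rparr>)"
      by (simp add: A.factorgroup_is_group)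
    show "group (multiplicative_group \<lparr>additive_group = ?A, multiplicative_group = ?M\<rparr>)"
      by (simp add: M.factorgroup_is_group)
  next
    fix X Y Z
    assume "X \<in> carrier (additive_group \<lparr>additive_group = ?A, multiplicative_group = ?M\<rparr>)"
      "Y \<in> carrier (additive_group \<lparr>additive_group = ?A, multiplicative_group = ?M\<rparr>)"
      "Z \<in> carrier (additive_group \<lparr>additive_group = ?A, multiplicative_group = ?M\<rparr>)"
    then obtain a b c where "X = ?c a" "Y = ?c b" "Z = ?c c"
      and abc: "a \<in> carrier (additive_group B)" "b \<in> carrier (additive_group B)"
        "c \<in> carrier (additive_group B)"
      by (auto simp: carrier_FactGroup)
    then show "X \<otimes>\<^bsub>multiplicative_group \<lparr>additive_group = ?A, multiplicative_group = ?M\<rparr>\<^esub>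
        (Y \<otimes>\<^bsub>additive_group \<lparr>additive_group = ?A, multiplicative_group = ?M\<rparr>\<^esub> Z) =
      X \<otimes>\<^bsub>multiplicative_group \<lparr>additive_group = ?A, multiplicative_group = ?M\<rparr>\<^esub> Y
        \<otimes>\<^bsub>additive_group \<lparr>additive_group = ?A, multiplicative_group = ?M\<rparr>\<^esub>
      inv\<^bsub>additive_group \<lparr>additive_group = ?A, multiplicative_group = ?M\<rparr>\<^esub> X
        \<otimes>\<^bsub>additive_group \<lparr>additive_group = ?A, multiplicative_group = ?M\<rparr>\<^esub>
      (X \<otimes>\<^bsub>multiplicative_group \<lparr>additive_group = ?A, multiplicative_group = ?M\<rparr>\<^esub> Z)"
      by (simp only: brace_ops.simps add mult inv brace_law add.m_closed add.inv_closed mult_closed)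
  qed (use carrier_quotient_brace[OF I] in \<open>simp add: quotient_brace_def\<close>)
  then show ?thesis by (simp add: quotient_brace_def)
qed

lemma skew_brace_iso_image:
  assumes f: "f \<in> brace_iso B C"
    and C: "group (additive_group C)" "group (multiplicative_group C)"
      "carrier (multiplicative_group C) = carrier (additive_group C)"
  shows "skew_brace C"
proof -
  interpret fA: group_hom "additive_group B" "additive_group C" f
    using f C by (simp add: group_hom_def group_hom_axioms_def brace_iso_def brace_hom_def)
  have mult: "f (a \<bullet> b) = f a \<otimes>\<^bsub>multiplicative_group C\<^esub> f b"
    if "a \<in> carrier (additive_group B)" "b \<in> carrier (additive_group B)" for a b
    using f that by (simp add: brace_iso_def brace_hom_def hom_def same_carrier)
  have surj: "carrier (additive_group C) = f ` carrier (additive_group B)"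
    using f by (simp add: brace_iso_def bij_betw_def)
  show ?thesis
  proof (intro skew_brace.intro skew_brace_axioms.intro C)
    fix x y z
    assume "x \<in> carrier (additive_group C)" "y \<in> carrier (additive_group C)"
      "z \<in> carrier (additive_group C)"
    then obtain a b c where "x = f a" "y = f b" "z = f c"
      and "a \<in> carrier (additive_group B)" "b \<in> carrier (additive_group B)"
        "c \<in> carrier (additive_group B)"
      unfolding surj by blast
    then show "x \<otimes>\<^bsub>multiplicative_group C\<^esub> (y \<otimes>\<^bsub>additive_group C\<^esub> z) =
      x \<otimes>\<^bsub>multiplicative_group C\<^esub> y \<otimes>\<^bsub>additive_group C\<^esub> inv\<^bsub>additive_group C\<^esub> x
        \<otimes>\<^bsub>additive_group C\<^esub> (x \<otimes>\<^bsub>multiplicative_group C\<^esub> z)"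
      by (simp add: brace_law flip: mult fA.hom_mult fA.hom_inv)
  qed
qed

end

section \<open>Skew braces with additive group a semidirect product with \<open>Z\<^sub>p\<close>\<close>

text \<open>A locale allows two skew braces over the same \<open>E\<close> and
  \<open>\<sigma>\<close> to be treated side by side in
  \<open>reduced_brace_isomorphic\<close>.\<close>

locale brace_over_Zp_semidirect = skew_brace B for B :: "(int \<times> 'e) brace_ops" +
  fixes p :: nat and E :: "'e monoid" and \<sigma> :: "'e \<Rightarrow> int"
  assumes prime_p: "prime p"
    and not_dvd_order: "\<not> p dvd order E"
    and normal_subgroups: "\<forall>H :: nat monoid. group H \<and> order H = order E * p \<longrightarrow>
      (\<exists>K. K \<lhd> H \<and> card K = p)"
    and group_E: "group E"
    and sigma_hom: "\<sigma> \<in> hom E (Zp_units p)"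
    and additive_group_eq: "additive_group B = Zp_semidirect p \<sigma> E"
begin

abbreviation "P \<equiv> Zp_part p E"

interpretation E: group E by (rule group_E)

lemma carrier_eq: "carrier (additive_group B) = {0..int p - 1} \<times> carrier E"
  by (simp add: additive_group_eq carrier_Zp_semidirect)

lemma p_gt_1: "1 < int p"
  using prime_gt_1_nat[OF prime_p] by simp

lemma sigma_range: "a \<in> carrier E \<Longrightarrow> 1 \<le> \<sigma> a \<and> \<sigma> a < int p"
  using sigma_hom by (auto simp: hom_def carrier_Zp_units[OF prime_p])

lemma coprime_p:
  assumes "1 \<le> u" "u < int p"
  shows "coprime u (int p)"
proof -
  have "\<not> int p dvd u" using assms by (intro zdvd_not_zless) simp_all
  then show ?thesis using prime_p by (metis coprime_commute prime_imp_coprime prime_nat_int_transfer)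
qed

lemma sigma_one: "\<sigma> \<one>\<^bsub>E\<^esub> = 1"
proof -
  have "\<sigma> (\<one>\<^bsub>E\<^esub> \<otimes>\<^bsub>E\<^esub> \<one>\<^bsub>E\<^esub>) = \<sigma> \<one>\<^bsub>E\<^esub> \<otimes>\<^bsub>Zp_units p\<^esub> \<sigma> \<one>\<^bsub>E\<^esub>"
    using sigma_hom E.one_closed by (rule hom_mult) (rule E.one_closed)
  then have "[\<sigma> \<one>\<^bsub>E\<^esub> * \<sigma> \<one>\<^bsub>E\<^esub> = \<sigma> \<one>\<^bsub>E\<^esub> * 1] (mod int p)"
    using sigma_range[OF E.one_closed] by (simp add: cong_def)
  moreover have "coprime (\<sigma> \<one>\<^bsub>E\<^esub>) (int p)"
    using sigma_range[OF E.one_closed] by (intro coprime_p) simp_all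
  ultimately have "[\<sigma> \<one>\<^bsub>E\<^esub> = 1] (mod int p)" by (simp only: cong_mult_lcancel)
  then show ?thesis using sigma_range[OF E.one_closed] p_gt_1 by (simp add: cong_def)
qed

text \<open>An infinite carrier would have \<open>order\<close> 0, which \<open>p\<close>
  divides.\<close>

lemma finite_carrier_E: "finite (carrier E)"
  using not_dvd_order by (metis card.infinite dvd_0_right order_def)

lemma coprime_order: "coprime p (order E)"
  using prime_p not_dvd_order by (rule prime_imp_coprime)

section \<open>\<open>Zp_part\<close> is an ideal\<close>

lemma snd_group_hom: "group_hom (additive_group B) E snd"
proof -
  have "snd \<in> hom (additive_group B) E"
    by (rule homI) (auto simp: carrier_eq, auto simp: additive_group_eq)
  then show ?thesis
    by (simp add: group_hom_def group_hom_axioms_def E.group_axioms add.group_axioms)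
qed

lemma Zp_part_eq_kernel: "P = kernel (additive_group B) E snd"
  by (auto simp: Zp_part_def kernel_def carrier_eq residue_ring_def)

lemma mem_Zp_part_iff: "x \<in> P \<longleftrightarrow> x \<in> carrier (additive_group B) \<and> snd x = \<one>\<^bsub>E\<^esub>"
  by (simp add: Zp_part_eq_kernel kernel_def)

lemma Zp_part_normal_add: "P \<lhd> additive_group B"
  unfolding Zp_part_eq_kernel by (rule group_hom.normal_kernel[OF snd_group_hom])

lemma card_Zp_part: "card P = p"
  by (simp add: Zp_part_def residue_ring_def card_cartesian_product)

text \<open>This describes \<open>P\<close> by the group operation alone, so endomorphisms preserve
  it. An element killed by \<open>p\<close> has trivial image in \<open>E\<close>, whose order is
  prime to \<open>p\<close>.\<close>

lemma mem_Zp_part_iff_pow: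
  assumes "x \<in> carrier (additive_group B)"
  shows "x \<in> P \<longleftrightarrow> x [^]\<^bsub>additive_group B\<^esub> p = \<one>\<^bsub>additive_group B\<^esub>"
proof
  assume "x \<in> P"
  then show "x [^]\<^bsub>additive_group B\<^esub> p = \<one>\<^bsub>additive_group B\<^esub>"
    using add.subgroup_pow_card[OF normal_imp_subgroup[OF Zp_part_normal_add]] card_Zp_part by metis
next
  assume "x [^]\<^bsub>additive_group B\<^esub> p = \<one>\<^bsub>additive_group B\<^esub>"
  then show "x \<in> P"
    using group_hom.hom_eq_one_if_coprime_pow[OF snd_group_hom assms _ coprime_order] assms
    by (simp add: mem_Zp_part_iff)
qed

lemma hom_Zp_part:
  assumes "\<phi> \<in> hom (additive_group B) (additive_group B)" "x \<in> P"
  shows "\<phi> x \<in> P"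
proof -
  interpret \<phi>: group_hom "additive_group B" "additive_group B" \<phi>
    using assms(1) by (simp add: group_hom_def group_hom_axioms_def add.group_axioms)
  have x: "x \<in> carrier (additive_group B)" using assms(2) by (simp add: mem_Zp_part_iff)
  have "\<phi> x [^]\<^bsub>additive_group B\<^esub> p = \<phi> (x [^]\<^bsub>additive_group B\<^esub> p)"
    using x by (simp add: \<phi>.hom_nat_pow)
  then show ?thesis using x assms(2) by (simp add: mem_Zp_part_iff_pow)
qed

lemma lambda_Zp_part:
  "a \<in> carrier (additive_group B) \<Longrightarrow> x \<in> P \<Longrightarrow> brace_lambda B a x \<in> P"
  using hom_Zp_part lambda_hom by blast

lemma Zp_part_subgroup_mult: "subgroup P (multiplicative_group B)"
proof (rule mult.subgroupI)
  interpret P: subgroup P "additive_group B" using Zp_part_normal_add normal_imp_subgroup by blast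
  show "P \<subseteq> carrier (multiplicative_group B)" using P.subset by (simp add: same_carrier)
  show "P \<noteq> {}" using P.one_closed by blast
  show "a \<bullet> b \<in> P" if "a \<in> P" "b \<in> P" for a b
    using that lambda_Zp_part by (simp add: mult_eq_add_lambda)
  show "inv\<^bsub>multiplicative_group B\<^esub> a \<in> P" if "a \<in> P" for a
  proof -
    let ?i = "inv\<^bsub>multiplicative_group B\<^esub> a"
    \<comment> \<open>By this choice \<open>?i \<cdot> l = ?i \<bullet> a\<close> is the identity,
      so \<open>?i\<close> is the additive inverse of an element of \<open>P\<close>.\<close>
    define l where "l = brace_lambda B ?i a"
    have a: "a \<in> carrier (additive_group B)" using that by simp
    then have l: "l \<in> P" unfolding l_def using that by (intro lambda_Zp_part) simp_all
    have "?i \<cdot> l = \<one>\<^bsub>additive_group B\<^esub>"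
      unfolding l_def using a by (simp add: same_carrier one_eq flip: mult_eq_add_lambda)
    then have "?i = inv\<^bsub>additive_group B\<^esub> l"
      using a l by (metis P.mem_carrier add.inv_equality mult_inv_closed)
    then show ?thesis using P.m_inv_closed[OF l] by simp
  qed
qed

lemma order_multiplicative_group: "order (multiplicative_group B) = order E * p"
  by (simp add: order_def same_carrier carrier_eq card_cartesian_product)

text \<open>The hypothesis gives some normal \<open>K\<close> of order \<open>p\<close>. Elements of
  \<open>P\<close> become trivial modulo \<open>K\<close>, where the quotient has order prime to
  \<open>p\<close>; so \<open>P\<close> lies in \<open>K\<close> and equals it by
  cardinality.\<close>

lemma Zp_part_normal_mult: "P \<lhd> multiplicative_group B"
proof -
  have fin: "finite (carrier (multiplicative_group B))"
    by (simp add: same_carrier carrier_eq finite_carrier_E)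
  have "\<forall>H :: nat monoid. group H \<and> order H = order (multiplicative_group B) \<longrightarrow>
      (\<exists>K. K \<lhd> H \<and> card K = p)"
    unfolding order_multiplicative_group by (rule normal_subgroups)
  then have "\<exists>K. K \<lhd> multiplicative_group B \<and> card K = p"
    by (rule mult.exists_normal_subgroup_transfer[OF _ fin])
  then obtain K where K: "K \<lhd> multiplicative_group B" "card K = p" by blast
  interpret K: normal K "multiplicative_group B" by fact
  let ?Q = "multiplicative_group B Mod K"
  interpret q: group_hom "multiplicative_group B" ?Q "\<lambda>x. K #>\<^bsub>multiplicative_group B\<^esub> x"
    using K.r_coset_hom_Mod K.factorgroup_is_group
    by (simp add: group_hom_def group_hom_axioms_def mult.group_axioms)
  have "card (rcosets\<^bsub>multiplicative_group B\<^esub> K) * p = order E * p"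
    using mult.lagrange[OF K.subgroup_axioms] K(2) by (simp add: order_multiplicative_group)
  then have "order ?Q = order E" using p_gt_1 by (simp add: order_def FactGroup_def)
  have "P \<subseteq> K"
  proof
    fix x assume x: "x \<in> P"
    then have xM: "x \<in> carrier (multiplicative_group B)"
      by (rule subgroup.mem_carrier[OF Zp_part_subgroup_mult])
    have "x [^]\<^bsub>multiplicative_group B\<^esub> p = \<one>\<^bsub>multiplicative_group B\<^esub>"
      using mult.subgroup_pow_card[OF Zp_part_subgroup_mult x] card_Zp_part by simp
    then have "K #>\<^bsub>multiplicative_group B\<^esub> x = \<one>\<^bsub>?Q\<^esub>"
      by (rule q.hom_eq_one_if_coprime_pow[OF xM]) (simp only: coprime_order \<open>order ?Q = order E\<close>)
    then have "K #>\<^bsub>multiplicative_group B\<^esub> x = K" by simp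
    then show "x \<in> K" by (rule mult.coset_join1[OF _ xM K.subgroup_axioms])
  qed
  moreover have "finite K" using K.subset fin by (rule finite_subset)
  ultimately have "P = K" using card_Zp_part K(2) by (intro card_subset_eq) simp_all
  show ?thesis unfolding \<open>P = K\<close> by (rule K(1))
qed

lemma ideal_Zp_part: "brace_ideal P B"
  by (simp add: brace_ideal_def Zp_part_normal_add Zp_part_normal_mult image_subset_iff lambda_Zp_part)

section \<open>The quotient carried over to \<open>E\<close>\<close>

abbreviation "Q \<equiv> quotient_brace B P"
abbreviation "R \<equiv> reduced_brace p E B"

lemma coset_label_coset:
  assumes "x \<in> carrier (additive_group B)"
  shows "coset_label (P #>\<^bsub>additive_group B\<^esub> x) = snd x"
proof -
  interpret s: group_hom "additive_group B" E snd by (rule snd_group_hom)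
  have "snd ` (P #>\<^bsub>additive_group B\<^esub> x) = {snd x}"
  proof
    show "snd ` (P #>\<^bsub>additive_group B\<^esub> x) \<subseteq> {snd x}"
      using assms by (auto simp: r_coset_def mem_Zp_part_iff)
    have "x \<in> P #>\<^bsub>additive_group B\<^esub> x"
      using assms normal_imp_subgroup[OF Zp_part_normal_add] by (rule add.rcos_self)
    then show "{snd x} \<subseteq> snd ` (P #>\<^bsub>additive_group B\<^esub> x)" by blast
  qed
  then show ?thesis by (simp add: coset_label_def)
qed

lemma coset_label_bij_betw: "bij_betw coset_label (carrier (additive_group Q)) (carrier E)"
proof -
  interpret s: group_hom "additive_group B" E snd by (rule snd_group_hom)
  have "coset_label ` carrier (additive_group Q) = snd ` carrier (additive_group B)"
    by (simp add: quotient_brace_def carrier_FactGroup coset_label_coset image_image)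
  also have "\<dots> = carrier E"
    using p_gt_1 by (simp add: carrier_eq)
  finally have "coset_label ` carrier (additive_group Q) = carrier E" .
  moreover have "inj_on coset_label (carrier (additive_group Q))"
  proof (rule inj_onI)
    fix X Y assume "X \<in> carrier (additive_group Q)" "Y \<in> carrier (additive_group Q)"
      and eq: "coset_label X = coset_label Y"
    then obtain x y where xy: "x \<in> carrier (additive_group B)" "y \<in> carrier (additive_group B)"
        "X = P #>\<^bsub>additive_group B\<^esub> x" "Y = P #>\<^bsub>additive_group B\<^esub> y"
      by (auto simp: quotient_brace_def carrier_FactGroup)
    with eq have "snd x = snd y" by (simp add: coset_label_coset)
    then show "X = Y"
      unfolding xy(3,4) Zp_part_eq_kernel using xy(1,2) by (intro equalityI s.FactGroup_subset) simp_all
  qed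
  ultimately show ?thesis
    by (simp add: bij_betw_def)
qed

text \<open>The multiplication of \<open>R\<close> is transported along \<open>coset_label\<close>,
  so that half holds by construction; the addition of \<open>R\<close> is that of \<open>E\<close>
  and is compared on representatives.\<close>

lemma coset_label_iso: "coset_label \<in> brace_iso Q R"
proof -
  interpret A: normal P "additive_group B" by (rule Zp_part_normal_add)
  interpret s: group_hom "additive_group B" E snd by (rule snd_group_hom)
  have "coset_label \<in> hom (additive_group Q) (additive_group R)"
  proof (rule homI)
    fix X Y assume "X \<in> carrier (additive_group Q)" "Y \<in> carrier (additive_group Q)"
    then show "coset_label (X \<otimes>\<^bsub>additive_group Q\<^esub> Y) =
        coset_label X \<otimes>\<^bsub>additive_group R\<^esub> coset_label Y"
      by (auto simp: quotient_brace_def reduced_brace_def carrier_FactGroup coset_label_coset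
          A.rcos_sum)
  qed (use bij_betwE[OF coset_label_bij_betw] in \<open>simp add: reduced_brace_def\<close>)
  moreover have "coset_label \<in> iso (multiplicative_group Q) (multiplicative_group R)"
    unfolding reduced_brace_def brace_ops.simps using coset_label_bij_betw
    by (intro inj_imp_image_group_iso)
      (simp add: carrier_quotient_brace[OF ideal_Zp_part] bij_betw_def)
  ultimately show ?thesis
    using coset_label_bij_betw
    by (simp add: brace_iso_def brace_hom_def reduced_brace_def iso_def)
qed

lemma carrier_reduced: "carrier (multiplicative_group R) = carrier E"
  using coset_label_bij_betw carrier_quotient_brace[OF ideal_Zp_part]
  by (simp add: reduced_brace_def image_group_carrier bij_betw_def)

lemma skew_brace_reduced: "skew_brace R"
proof (rule skew_brace.skew_brace_iso_image[OF skew_brace_quotient[OF ideal_Zp_part] coset_label_iso])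
  interpret Q: skew_brace Q by (rule skew_brace_quotient[OF ideal_Zp_part])
  show "group (additive_group R)" by (simp add: reduced_brace_def E.group_axioms)
  show "group (multiplicative_group R)"
    unfolding reduced_brace_def brace_ops.simps using coset_label_bij_betw
    by (intro Q.mult.inj_imp_image_group_is_group) (simp add: Q.same_carrier bij_betw_def)
  show "carrier (multiplicative_group R) = carrier (additive_group R)"
    by (simp add: carrier_reduced) (simp add: reduced_brace_def)
qed

text \<open>Here \<open>snd\<close> is the multiplicative quotient map followed by
  \<open>coset_label\<close>, since the two kinds of cosets agree.\<close>

lemma snd_group_hom_mult: "group_hom (multiplicative_group B) (multiplicative_group R) snd"
proof -
  interpret M: normal P "multiplicative_group B" by (rule Zp_part_normal_mult)
  interpret R: skew_brace R by (rule skew_brace_reduced)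
  have "coset_label \<in> hom (multiplicative_group B Mod P) (multiplicative_group R)"
    using coset_label_iso by (simp add: brace_iso_def brace_hom_def quotient_brace_def)
  then have "coset_label \<circ> (\<lambda>x. P #>\<^bsub>multiplicative_group B\<^esub> x)
      \<in> hom (multiplicative_group B) (multiplicative_group R)"
    by (rule hom_compose[OF M.r_coset_hom_Mod])
  then have "snd \<in> hom (multiplicative_group B) (multiplicative_group R)"
    by (rule mult.hom_restrict)
      (simp add: same_carrier ideal_cosets_eq[OF ideal_Zp_part] coset_label_coset)
  then show ?thesis
    by (simp add: group_hom_def group_hom_axioms_def mult.group_axioms R.mult.group_axioms)
qed

lemma snd_mult:
  assumes "x \<in> carrier (additive_group B)" "y \<in> carrier (additive_group B)"
  shows "snd (x \<bullet> y) = snd x \<otimes>\<^bsub>multiplicative_group R\<^esub> snd y"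
  using group_hom.hom_mult[OF snd_group_hom_mult] assms by (simp add: same_carrier)

section \<open>Invariance of \<open>\<sigma>\<close> under automorphisms of the additive
  group\<close>

lemma pow_Zp_part:
  "(u, \<one>\<^bsub>E\<^esub>) [^]\<^bsub>additive_group B\<^esub> (k :: nat) = (int k * u mod int p, \<one>\<^bsub>E\<^esub>)"
proof (induction k)
  case 0
  then show ?case by (simp add: additive_group_eq one_Zp_semidirect)
next
  case (Suc k)
  have "(int k * u mod int p, \<one>\<^bsub>E\<^esub>) \<cdot> (u, \<one>\<^bsub>E\<^esub>) = (int (Suc k) * u mod int p, \<one>\<^bsub>E\<^esub>)"
    by (simp add: additive_group_eq sigma_one distrib_right mod_add_right_eq add.commute)
  with Suc show ?case by simp
qed

text \<open>With \<open>z = (1, 1)\<close> and \<open>y = (k, b)\<close> one has \<open>y \<cdot> z = z\<^sup>j \<cdot> y\<close> for \<open>j = \<sigma> b\<close>. Since \<open>\<phi> z = (u, 1)\<close> with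
  \<open>u\<close> prime to \<open>p\<close>, applying \<open>\<phi>\<close> to this relation and cancelling \<open>u\<close> gives the claim.\<close>

lemma sigma_snd_hom:
  assumes \<phi>: "\<phi> \<in> hom (additive_group B) (additive_group B)"
    and inj: "inj_on \<phi> (carrier (additive_group B))"
    and y: "y \<in> carrier (additive_group B)"
  shows "\<sigma> (snd (\<phi> y)) = \<sigma> (snd y)"
proof -
  interpret \<phi>: group_hom "additive_group B" "additive_group B" \<phi>
    using \<phi> by (simp add: group_hom_def group_hom_axioms_def add.group_axioms)
  obtain k b where kb: "y = (k, b)" "0 \<le> k" "k < int p" "b \<in> carrier E"
    using y by (auto simp: carrier_eq)
  obtain l c where lc: "\<phi> y = (l, c)" "c \<in> carrier E"
    using \<phi>.hom_closed[OF y] by (auto simp: carrier_eq)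
  define z where "z = (1 :: int, \<one>\<^bsub>E\<^esub>)"
  have z: "z \<in> carrier (additive_group B)" using p_gt_1 by (simp add: z_def carrier_eq)
  then have "\<phi> z \<in> P" using hom_Zp_part[OF \<phi>] by (simp add: mem_Zp_part_iff z_def)
  then obtain u where u: "\<phi> z = (u, \<one>\<^bsub>E\<^esub>)" "0 \<le> u" "u < int p"
    by (auto simp: Zp_part_def residue_ring_def)
  \<comment> \<open>Injectivity of \<open>\<phi>\<close> keeps the scalar \<open>u\<close> nonzero
    modulo \<open>p\<close>.\<close>
  have "z \<noteq> \<one>\<^bsub>additive_group B\<^esub>" by (simp add: z_def additive_group_eq one_Zp_semidirect)
  then have "\<phi> z \<noteq> \<one>\<^bsub>additive_group B\<^esub>" using inj z by (metis \<phi>.hom_one add.one_closed inj_onD)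
  then have "u \<noteq> 0" using u by (auto simp: additive_group_eq one_Zp_semidirect)
  have "y \<cdot> z = z [^]\<^bsub>additive_group B\<^esub> nat (\<sigma> b) \<cdot> y"
    unfolding z_def pow_Zp_part using kb sigma_range[of b]
    by (simp add: additive_group_eq sigma_one add.commute)
  then have "\<phi> y \<cdot> \<phi> z = \<phi> z [^]\<^bsub>additive_group B\<^esub> nat (\<sigma> b) \<cdot> \<phi> y"
    using y z by (metis \<phi>.hom_mult \<phi>.hom_nat_pow add.nat_pow_closed)
  then have "[l + \<sigma> c * u = \<sigma> b * u + l] (mod int p)"
    using u(1) lc kb sigma_range[of b]
    by (simp add: pow_Zp_part) (simp add: additive_group_eq sigma_one cong_def mod_add_left_eq)
  then have "[\<sigma> c * u = \<sigma> b * u] (mod int p)" by (simp add: add.commute[of l] cong_add_rcancel)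
  moreover have "coprime u (int p)"
    using \<open>u \<noteq> 0\<close> u by (intro coprime_p) simp_all
  ultimately have "[\<sigma> c = \<sigma> b] (mod int p)" by (simp add: cong_mult_rcancel)
  then show ?thesis
    using sigma_range[of b] sigma_range[of c] kb lc by (simp add: cong_def)
qed

lemma sigma_brace_hom: "\<sigma> \<in> brace_hom R (Zp_units_brace p)"
proof -
  have "\<sigma> \<in> hom (multiplicative_group R) (Zp_units p)"
  proof (rule homI)
    fix a b assume ab: "a \<in> carrier (multiplicative_group R)" "b \<in> carrier (multiplicative_group R)"
    \<comment> \<open>Lifts of \<open>a\<close> and \<open>b\<close> along \<open>snd\<close>, so
      that the product in \<open>R\<close> can be computed in \<open>B\<close> as
      \<open>x \<cdot> ?l y\<close>.\<close>
    define x y where "x = (0 :: int, a)" and "y = (0 :: int, b)"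
    have xy: "x \<in> carrier (additive_group B)" "y \<in> carrier (additive_group B)"
      using ab p_gt_1 by (simp_all add: x_def y_def carrier_reduced carrier_eq)
    let ?l = "brace_lambda B x"
    have inj: "inj_on ?l (carrier (additive_group B))"
      using xy(1) by (intro inj_onI) (simp add: brace_lambda_def same_carrier)
    have "a \<otimes>\<^bsub>multiplicative_group R\<^esub> b = snd (x \<bullet> y)" using xy by (simp add: snd_mult x_def y_def)
    also have "\<dots> = a \<otimes>\<^bsub>E\<^esub> snd (?l y)"
      using xy group_hom.hom_mult[OF snd_group_hom, of x "?l y"]
      by (simp add: mult_eq_add_lambda) (simp add: x_def)
    finally have "\<sigma> (a \<otimes>\<^bsub>multiplicative_group R\<^esub> b) = \<sigma> a \<otimes>\<^bsub>Zp_units p\<^esub> \<sigma> (snd (?l y))"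
      using sigma_hom ab xy group_hom.hom_closed[OF snd_group_hom, of "?l y"]
      by (simp add: hom_mult carrier_reduced)
    also have "\<sigma> (snd (?l y)) = \<sigma> b"
      using sigma_snd_hom[OF lambda_hom[OF xy(1)] inj xy(2)] by (simp add: y_def)
    finally show "\<sigma> (a \<otimes>\<^bsub>multiplicative_group R\<^esub> b) = \<sigma> a \<otimes>\<^bsub>Zp_units p\<^esub> \<sigma> b" .
  qed (use sigma_hom in \<open>simp add: carrier_reduced hom_def Pi_iff\<close>)
  then show ?thesis
    using sigma_hom by (simp add: brace_hom_def Zp_units_brace_def) (simp add: reduced_brace_def)
qed

lemma kernel_snd_mult: "kernel (multiplicative_group B) (multiplicative_group R) snd = P"
proof -
  have "\<one>\<^bsub>multiplicative_group R\<^esub> = \<one>\<^bsub>E\<^esub>"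
    using skew_brace.one_eq[OF skew_brace_reduced] by (simp add: reduced_brace_def)
  then show ?thesis by (simp add: kernel_def same_carrier set_eq_iff mem_Zp_part_iff)
qed

lemma snd_image_mult: "snd ` carrier (multiplicative_group B) = carrier (multiplicative_group R)"
  using p_gt_1 by (simp add: same_carrier carrier_eq carrier_reduced)

lemma multiplicative_group_iso:
  "\<exists>\<tau> \<in> hom (multiplicative_group R) (Zp_units p).
    multiplicative_group B \<cong> Zp_semidirect p \<tau> (multiplicative_group R)"
  by (rule iso_Zp_semidirect[OF snd_group_hom_mult snd_image_mult prime_p])
    (use not_dvd_order in \<open>simp_all add: kernel_snd_mult card_Zp_part order_def carrier_reduced\<close>)

end

text \<open>An isomorphism \<open>f\<close> preserves and reflects membership in
  \<open>Zp_part\<close>, so it induces a map \<open>h\<close> on \<open>E\<close> compatible with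
  both operations.\<close>

lemma reduced_brace_isomorphic:
  assumes "brace_over_Zp_semidirect B p E \<sigma>" "brace_over_Zp_semidirect B' p E \<sigma>"
    and "brace_isomorphic B B'"
  shows "brace_isomorphic (reduced_brace p E B) (reduced_brace p E B')"
proof -
  interpret B: brace_over_Zp_semidirect B p E \<sigma> by fact
  interpret B': brace_over_Zp_semidirect B' p E \<sigma> by fact
  let ?A = "additive_group B" and ?P = "Zp_part p E"
  \<comment> \<open>With equal additive groups, \<open>f\<close> is an injective endomorphism of a
    single group.\<close>
  have A: "additive_group B' = ?A" by (simp add: B.additive_group_eq B'.additive_group_eq)
  obtain f where f: "f \<in> brace_iso B B'"
    using assms(3) by (auto simp: brace_isomorphic_def)
  then have f_add: "f \<in> hom ?A ?A" and inj: "inj_on f (carrier ?A)"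
    and f_mult: "f \<in> hom (multiplicative_group B) (multiplicative_group B')"
    by (simp_all add: brace_iso_def brace_hom_def A bij_betw_def)
  interpret f: group_hom ?A ?A f
    using f_add by (simp add: group_hom_def group_hom_axioms_def B.add.group_axioms)
  interpret s: group_hom ?A E snd by (rule B.snd_group_hom)
  interpret sf: group_hom ?A E "\<lambda>x. snd (f x)"
    using hom_compose[OF f_add s.homh]
    by (simp add: group_hom_def group_hom_axioms_def B.add.group_axioms B.group_E comp_def)
  have P_iff: "f x \<in> ?P \<longleftrightarrow> x \<in> ?P" if "x \<in> carrier ?A" for x
  proof
    \<comment> \<open>Injectivity reflects the condition that the \<open>p\<close>-th power is
      trivial.\<close>
    assume "f x \<in> ?P"
    then have "f (x [^]\<^bsub>?A\<^esub> p) = f \<one>\<^bsub>?A\<^esub>"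
      using that by (simp add: B.mem_Zp_part_iff_pow f.hom_nat_pow)
    then have "x [^]\<^bsub>?A\<^esub> p = \<one>\<^bsub>?A\<^esub>" by (rule inj_onD[OF inj]) (simp_all add: that)
    then show "x \<in> ?P" using that by (simp add: B.mem_Zp_part_iff_pow)
  qed (rule B.hom_Zp_part[OF f_add])
  have snd_f: "snd (f x) = snd (f y) \<longleftrightarrow> snd x = snd y"
    if "x \<in> carrier ?A" "y \<in> carrier ?A" for x y
  proof -
    let ?d = "x \<otimes>\<^bsub>?A\<^esub> inv\<^bsub>?A\<^esub> y"
    have "snd (f ?d) = \<one>\<^bsub>E\<^esub> \<longleftrightarrow> snd ?d = \<one>\<^bsub>E\<^esub>"
      using P_iff[of ?d] that by (simp only: B.mem_Zp_part_iff) simp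
    then show ?thesis
      using that by (simp add: s.H.inv_solve_right')
  qed
  \<comment> \<open>The lift \<open>(0, a)\<close> is one choice; by \<open>snd_f\<close> every lift
    of \<open>a\<close> gives the same value.\<close>
  define h where "h a = snd (f (0, a))" for a
  have zero: "(0, a) \<in> carrier ?A" if "a \<in> carrier E" for a
    using that B.p_gt_1 by (simp add: B.carrier_eq)
  have h: "h (snd x) = snd (f x)" if "x \<in> carrier ?A" for x
    using that zero[of "snd x"] snd_f[of "(0, snd x)" x] by (simp add: h_def)
  have closed: "h a \<in> carrier E" if "a \<in> carrier E" for a
    using sf.hom_closed[OF zero[OF that]] by (simp add: h_def)
  have "inj_on h (carrier E)"
    using zero by (intro inj_onI) (simp add: h_def snd_f)
  moreover have "h ` carrier E \<subseteq> carrier E" using closed by blast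
  ultimately have bij: "bij_betw h (carrier E) (carrier E)"
    using endo_inj_surj[OF B.finite_carrier_E] by (simp add: bij_betw_def)
  have "h \<in> hom E E"
  proof (rule homI)
    fix a b assume ab: "a \<in> carrier E" "b \<in> carrier E"
    then have "h (snd ((0, a) \<otimes>\<^bsub>?A\<^esub> (0, b))) = h a \<otimes>\<^bsub>E\<^esub> h b"
      using zero by (subst h) (simp_all add: h_def)
    then show "h (a \<otimes>\<^bsub>E\<^esub> b) = h a \<otimes>\<^bsub>E\<^esub> h b" using ab zero by simp
  qed (rule closed)
  moreover have "h \<in> hom (multiplicative_group B.R) (multiplicative_group B'.R)"
  proof (rule homI)
    fix a b assume "a \<in> carrier (multiplicative_group B.R)" "b \<in> carrier (multiplicative_group B.R)"
    then have z: "(0, a) \<in> carrier ?A" "(0, b) \<in> carrier ?A"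
      using zero by (simp_all add: B.carrier_reduced)
    have "h (snd ((0, a) \<otimes>\<^bsub>multiplicative_group B\<^esub> (0, b)))
        = snd (f (0, a) \<otimes>\<^bsub>multiplicative_group B'\<^esub> f (0, b))"
      using z f_mult by (subst h) (simp_all add: hom_mult B.same_carrier)
    then show "h (a \<otimes>\<^bsub>multiplicative_group B.R\<^esub> b) = h a \<otimes>\<^bsub>multiplicative_group B'.R\<^esub> h b"
      using z by (simp add: B.snd_mult B'.snd_mult A h_def)
  qed (simp add: B.carrier_reduced B'.carrier_reduced closed)
  ultimately have "h \<in> brace_iso B.R B'.R"
    using bij by (simp add: brace_iso_def brace_hom_def) (simp add: reduced_brace_def)
  then show ?thesis by (auto simp: brace_isomorphic_def)
qed

theorem theorem2p9:
  fixes p n :: nat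
    and E :: "'e monoid"
    and \<sigma> :: "'e \<Rightarrow> int"
    and B :: "(int \<times> 'e) brace_ops"
  assumes "prime p" and "odd p" and "n > 0" and "\<not> p dvd n"
    and "\<forall>H :: nat monoid. group H \<and> order H = n * p \<longrightarrow> (\<exists>K. K \<lhd> H \<and> card K = p)"
    and "group E" and "order E = n"
    and "\<not> p dvd order (AutoGroup E)"
    and "\<sigma> \<in> hom E (Zp_units p)"
    and "skew_brace B" and "additive_group B = Zp_semidirect p \<sigma> E"
  shows "brace_ideal (Zp_part p E) B \<and>
         skew_brace (quotient_brace B (Zp_part p E)) \<and>
         skew_brace (reduced_brace p E B) \<and>
         coset_label \<in> brace_iso (quotient_brace B (Zp_part p E)) (reduced_brace p E B) \<and>
         \<sigma> \<in> brace_hom (reduced_brace p E B) (Zp_units_brace p) \<and>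
         (\<exists>\<tau> \<in> hom (multiplicative_group (reduced_brace p E B)) (Zp_units p).
            multiplicative_group B \<cong>
            Zp_semidirect p \<tau> (multiplicative_group (reduced_brace p E B))) \<and>
         (\<forall>B'. skew_brace B' \<and> additive_group B' = Zp_semidirect p \<sigma> E \<and>
               brace_isomorphic B B' \<longrightarrow>
               brace_isomorphic (reduced_brace p E B) (reduced_brace p E B'))"
proof -
  \<comment> \<open>Stated for arbitrary \<open>C\<close> because it serves both \<open>B\<close>
    and every \<open>B'\<close> isomorphic to it.\<close>
  have over: "brace_over_Zp_semidirect C p E \<sigma>"
    if "skew_brace C" "additive_group C = Zp_semidirect p \<sigma> E" for C
    using that assms by (simp add: brace_over_Zp_semidirect_def brace_over_Zp_semidirect_axioms_def)
  interpret brace_over_Zp_semidirect B p E \<sigma>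
    using assms by (intro over)
  show ?thesis
    using ideal_Zp_part skew_brace_quotient[OF ideal_Zp_part] skew_brace_reduced coset_label_iso
      sigma_brace_hom multiplicative_group_iso
      reduced_brace_isomorphic[OF brace_over_Zp_semidirect_axioms over]
    by (intro conjI) blast+
qed

end
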